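(* Let $f_1,\dots,f_k$ be non-constant rational functions with algebraic coefficients and let $\lambda_1,\dots,\lambda_k$ be nonzero algebraic numbers. Assume that $f_i/f_j$ is not a constant function for $i\neq j$. If $$\sum_{i=1}^k\lambda_i(f_i(x))^n\in\overline{\mathbb{Z}}[x]$$ for all $n$ in an infinite set $\mathfrak{S}\subseteq\mathbb{N}$, then $f_i(x)\in\overline{\mathbb{Z}}[x]$ for every $i$.
   Context: $\overline{\mathbb{Z}}$ denotes the ring of all algebraic integers and $\overline{\mathbb{Z}}[x]$ the ring of polynomials with coefficients in it. *)

theory Defs
  imports Complex_Main "HOL-Computational_Algebra.Polynomial" "HOL-Computational_Algebra.Fraction_Field"
begin

type_synonym ratfun = "complex poly fract"

definition rf_of_poly :: "complex poly \<Rightarrow> ratfun" where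
  "rf_of_poly p = Fract p 1"

definition rf_const :: "ratfun \<Rightarrow> bool" where
  "rf_const f \<longleftrightarrow> (\<exists>c::complex. f = rf_of_poly [:c:])"

definition alg_ratfun :: "ratfun \<Rightarrow> bool" where
  "alg_ratfun f \<longleftrightarrow> (\<exists>p q. q \<noteq> 0 \<and> (\<forall>i. algebraic (coeff p i)) \<and>
      (\<forall>i. algebraic (coeff q i)) \<and> f = Fract p q)"

definition in_Zbar_poly :: "ratfun \<Rightarrow> bool" where
  "in_Zbar_poly f \<longleftrightarrow> (\<exists>P. (\<forall>i. algebraic_int (coeff P i)) \<and> f = rf_of_poly P)"

end

theory Submission
  imports Defs "Jordan_Normal_Form.Char_Poly"
    "HOL-Computational_Algebra.Fundamental_Theorem_Algebra" "HOL-Real_Asymp.Real_Asymp"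
begin

text \<open>
  Write \<open>f\<^sub>i = p\<^sub>i / q\<close> with \<open>p\<^sub>i\<close> and \<open>q\<close> integral, that is, with algebraic integer coefficients. First-order
  differential operators eliminate all but one summand of \<open>\<Sum>\<^sub>i \<lambda>\<^sub>i p\<^sub>i\<^sup>n = q\<^sup>n g\<^sub>n\<close> and show that
  \<open>C\<^sub>n p\<^sub>i\<^sup>n / q\<^sup>n\<close> is an integral polynomial, where \<open>C\<^sub>n\<close> depends polynomially on \<open>n\<close>; the family \<open>C\<^sub>n\<close> is not
  identically zero because no Wronskian of two of the \<open>p\<^sub>i\<close> vanishes. As \<open>C\<^sub>n\<close> has bounded degree
  in \<open>x\<close>, \<open>q\<close> divides \<open>p\<^sub>i\<close>. So \<open>f\<^sub>i\<close> is a polynomial and \<open>C\<^sub>n f\<^sub>i\<^sup>n\<close> is integral. Cancelling monic factors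
  preserves integrality and yields integers \<open>N\<^sub>n\<close> of polynomial growth such that \<open>N\<^sub>n b\<^sup>n\<close> is integral
  for every \<open>b\<close> that is the leading coefficient of \<open>f\<^sub>i\<close> times a product of negated roots of \<open>f\<^sub>i\<close>. If
  \<open>b\<close> were not integral, some prime would divide \<open>N\<^sub>n\<close> to a power linear in \<open>n\<close>, which is impossible.
  The coefficients of \<open>f\<^sub>i\<close> are sums of such \<open>b\<close>.
\<close>

hide_const (open) Module.module.smult

section \<open>The ring of algebraic integers\<close>

interpretation zmod: Modules.module "\<lambda>(n::int) (x::complex). of_int n * x"
  by unfold_locales (simp_all add: algebra_simps)

text \<open>Integrality is tested on finitely generated subgroups of the complex numbers that
  contain 1. The numbers that multiply a fixed subgroup into itself form a ring, which yields
  closure under sums and products.\<close>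

definition stabilizes :: "complex set \<Rightarrow> complex \<Rightarrow> bool" where
  "stabilizes B x \<longleftrightarrow> (\<forall>b\<in>zmod.span B. x * b \<in> zmod.span B)"

lemma stabilizesI:
  assumes "\<And>b. b \<in> B \<Longrightarrow> x * b \<in> zmod.span B"
  shows "stabilizes B x"
  unfolding stabilizes_def
proof
  fix b assume "b \<in> zmod.span B"
  then show "x * b \<in> zmod.span B"
  proof (induction rule: zmod.span_induct_alt)
    case base
    show ?case by (simp add: zmod.span_zero)
  next
    case (step c y z)
    have "x * (of_int c * y + z) = of_int c * (x * y) + x * z"
      by (simp add: algebra_simps)
    with step assms show ?case
      by (simp add: zmod.span_add zmod.span_scale)
  qed
qed

lemma stabilizes_of_int: "stabilizes B (of_int n)"
  by (simp add: stabilizes_def zmod.span_scale)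

lemma stabilizes_add: "stabilizes B x \<Longrightarrow> stabilizes B y \<Longrightarrow> stabilizes B (x + y)"
  by (simp add: stabilizes_def distrib_right zmod.span_add)

lemma stabilizes_mult: "stabilizes B x \<Longrightarrow> stabilizes B y \<Longrightarrow> stabilizes B (x * y)"
  by (simp add: stabilizes_def mult.assoc)

text \<open>Determinant trick: multiplication by \<open>x\<close> on the generators is given by an
  integer matrix \<open>M\<close>. The vector of generators is an eigenvector, nonzero because 1 is
  an entry, so \<open>x\<close> is a root of the monic integer polynomial
  \<open>char_poly M\<close>.\<close>

lemma algebraic_int_if_stabilizes:
  assumes "finite B" "1 \<in> B" "stabilizes B x"
  shows "algebraic_int x"
proof -
  obtain bs where bs: "set bs = B" "distinct bs"
    using finite_distinct_list[OF \<open>finite B\<close>] by blast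
  define n where "n = length bs"
  have "\<exists>u. x * b = (\<Sum>v\<in>B. of_int (u v) * v)" if "b \<in> B" for b
  proof -
    have "x * b \<in> zmod.span B"
      using assms that by (auto simp: stabilizes_def zmod.span_base)
    then show ?thesis
      unfolding zmod.span_finite[OF \<open>finite B\<close>] by auto
  qed
  then obtain u where u: "\<And>b. b \<in> B \<Longrightarrow> x * b = (\<Sum>v\<in>B. of_int (u b v :: int) * v)"
    by metis
  define M where "M = mat n n (\<lambda>(i, j). u (bs ! i) (bs ! j))"
  define v where "v = vec n (\<lambda>i. bs ! i)"
  let ?M = "map_mat complex_of_int M"
  have M: "M \<in> carrier_mat n n" and M': "?M \<in> carrier_mat n n"
    by (auto simp: M_def)
  have "?M *\<^sub>v v = x \<cdot>\<^sub>v v"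
  proof (rule eq_vecI)
    fix i assume "i < dim_vec (x \<cdot>\<^sub>v v)"
    then have i: "i < n" by (simp add: v_def)
    have "(?M *\<^sub>v v) $ i = (\<Sum>j<n. of_int (u (bs ! i) (bs ! j)) * bs ! j)"
      using i by (simp add: v_def M_def scalar_prod_def row_def lessThan_atLeast0)
    also have "\<dots> = (\<Sum>v\<in>B. of_int (u (bs ! i) v) * v)"
      by (intro sum.reindex_bij_betw bij_betw_nth) (use bs in \<open>auto simp: n_def\<close>)
    also have "\<dots> = x * bs ! i"
      using u[of "bs ! i"] bs i nth_mem[of i bs] by (simp add: n_def)
    finally show "(?M *\<^sub>v v) $ i = (x \<cdot>\<^sub>v v) $ i"
      using i by (simp add: v_def)
  qed (simp add: v_def M_def)
  moreover have "v \<noteq> 0\<^sub>v n"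
  proof -
    obtain i where i: "i < n" "bs ! i = 1"
      using assms bs by (metis in_set_conv_nth n_def)
    then have "v $ i \<noteq> 0\<^sub>v n $ i"
      by (simp add: v_def)
    then show ?thesis by metis
  qed
  ultimately have "eigenvalue ?M x"
    unfolding eigenvalue_def eigenvector_def by (intro exI[of _ v]) (use M in \<open>auto simp: v_def\<close>)
  then have "poly (map_poly of_int (char_poly M)) x = 0"
    unfolding eigenvalue_root_char_poly[OF M'] of_int_hom.char_poly_hom[OF M] .
  with degree_monic_char_poly[OF M] show ?thesis
    unfolding algebraic_int_altdef_ipoly by auto
qed

text \<open>The products \<open>b * z ^ i\<close> with \<open>i < d\<close> generate the larger
  module; the monic relation brings \<open>z ^ d\<close> back into their span. The coefficients may
  be any stabilizers of the old span, so this serves for integer and for integral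
  coefficients.\<close>

lemma stabilizes_extend:
  assumes "finite B" "1 \<in> B" and c: "\<And>i. i < d \<Longrightarrow> stabilizes B (c i)"
    and z: "z ^ d = (\<Sum>i<d. c i * z ^ i)"
  obtains B' where "finite B'" "1 \<in> B'" "stabilizes B' z" "\<And>y. stabilizes B y \<Longrightarrow> stabilizes B' y"
proof
  define B' where "B' = (\<lambda>(b, i). b * z ^ i) ` (B \<times> {..<d})"
  \<comment> \<open>For \<open>d = 0\<close> the relation would read 1 = 0. Positivity puts 1 into
    \<open>B'\<close>.\<close>
  have "d > 0" using z by (cases d) auto
  show "finite B'" using \<open>finite B\<close> by (simp add: B'_def)
  have mem: "b * z ^ i \<in> B'" if "b \<in> B" "i < d" for b i
    using that by (auto simp: B'_def)
  from mem[OF \<open>1 \<in> B\<close> \<open>d > 0\<close>] show "1 \<in> B'" by simp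
  have span: "b * z ^ i \<in> zmod.span B'" if "b \<in> zmod.span B" "i < d" for b i
    using that(1)
  proof (induction rule: zmod.span_induct_alt)
    case base
    show ?case by (simp add: zmod.span_zero)
  next
    case (step m x y)
    have "(of_int m * x + y) * z ^ i = of_int m * (x * z ^ i) + y * z ^ i"
      by (simp add: algebra_simps)
    with step mem[OF _ that(2)] show ?case
      by (simp add: zmod.span_add zmod.span_scale zmod.span_base)
  qed
  show "stabilizes B' z"
  proof (rule stabilizesI)
    fix x assume "x \<in> B'"
    then obtain b i where x: "x = b * z ^ i" "b \<in> B" "i < d" by (auto simp: B'_def)
    show "z * x \<in> zmod.span B'"
    proof (cases "Suc i < d")
      case True
      then show ?thesis using mem[of b "Suc i"] x by (auto simp: mult.left_commute intro: zmod.span_base)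
    next
      case False
      then have "d = Suc i" using x by simp
      then have "z * x = b * z ^ d" using x by simp
      also have "\<dots> = (\<Sum>i<d. (c i * b) * z ^ i)"
        by (simp add: z sum_distrib_left mult_ac)
      also have "\<dots> \<in> zmod.span B'"
      proof (rule zmod.span_sum)
        fix i assume "i \<in> {..<d}"
        then show "(c i * b) * z ^ i \<in> zmod.span B'"
          using c[of i] x by (intro span) (auto simp: stabilizes_def zmod.span_base)
      qed
      finally show ?thesis .
    qed
  qed
  show "stabilizes B' y" if "stabilizes B y" for y
  proof (rule stabilizesI)
    fix x assume "x \<in> B'"
    then obtain b i where x: "x = b * z ^ i" "b \<in> B" "i < d" by (auto simp: B'_def)
    then show "y * x \<in> zmod.span B'"
      using span[of "y * b" i] that by (auto simp: stabilizes_def zmod.span_base mult.assoc)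
  qed
qed

lemma monic_root_power:
  fixes p :: "'a :: comm_ring_1 poly"
  assumes "lead_coeff p = 1" "poly p x = 0"
  shows "x ^ degree p = (\<Sum>i<degree p. - coeff p i * x ^ i)"
proof -
  have "poly p x = (\<Sum>i<degree p. coeff p i * x ^ i) + x ^ degree p"
    unfolding poly_altdef lessThan_Suc_atMost[symmetric] using assms by simp
  with assms show ?thesis
    by (simp add: sum_negf eq_neg_iff_add_eq_0 add.commute)
qed

text \<open>The numbers are adjoined one at a time, starting from the span of 1; each adjunction
  keeps the earlier stabilizers.\<close>

lemma algebraic_ints_stabilize:
  assumes "finite X" "\<And>x. x \<in> X \<Longrightarrow> algebraic_int x"
  shows "\<exists>B. finite B \<and> 1 \<in> B \<and> (\<forall>x\<in>X. stabilizes B x)"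
  using assms
proof (induction X)
  case empty
  show ?case by (rule exI[of _ "{1}"]) simp
next
  case (insert x X)
  then obtain B where B: "finite B" "1 \<in> B" "\<forall>x\<in>X. stabilizes B x" by auto
  obtain p where p: "lead_coeff p = 1" "\<forall>i. coeff p i \<in> \<int>" "poly p x = 0"
    using insert.prems[of x] by (auto elim: algebraic_int.cases)
  have "stabilizes B (- coeff p i)" for i
    using p(2) stabilizes_of_int[of B] by (metis Ints_cases of_int_minus)
  from stabilizes_extend[OF B(1,2) this monic_root_power[OF p(1,3)]]
  show ?case using B(3) by (metis insert_iff)
qed

lemma algebraic_int_add:
  fixes x y :: complex
  assumes "algebraic_int x" "algebraic_int y"
  shows "algebraic_int (x + y)"
  using algebraic_ints_stabilize[of "{x, y}"] assms
  by (auto intro: algebraic_int_if_stabilizes stabilizes_add)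

lemma algebraic_int_diff:
  fixes x y :: complex
  assumes "algebraic_int x" "algebraic_int y"
  shows "algebraic_int (x - y)"
  using algebraic_int_add[of x "- y"] assms by simp

lemma algebraic_int_mult:
  fixes x y :: complex
  assumes "algebraic_int x" "algebraic_int y"
  shows "algebraic_int (x * y)"
  using algebraic_ints_stabilize[of "{x, y}"] assms
  by (auto intro: algebraic_int_if_stabilizes stabilizes_mult)

lemma algebraic_int_sum:
  fixes g :: "'a \<Rightarrow> complex"
  shows "(\<And>x. x \<in> X \<Longrightarrow> algebraic_int (g x)) \<Longrightarrow> algebraic_int (sum g X)"
  by (induction X rule: infinite_finite_induct) (auto intro: algebraic_int_add)

lemma algebraic_int_power: "algebraic_int (x :: complex) \<Longrightarrow> algebraic_int (x ^ n)"
  by (induction n) (auto intro: algebraic_int_mult)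

text \<open>Integral closedness: \<open>z\<close> is adjoined to a module that all coefficients
  stabilize.\<close>

lemma algebraic_int_monic_root:
  fixes z :: complex
  assumes "\<And>i. i < d \<Longrightarrow> algebraic_int (c i)" and z: "z ^ d = (\<Sum>i<d. c i * z ^ i)"
  shows "algebraic_int z"
proof -
  obtain B where B: "finite B" "1 \<in> B" "\<forall>i<d. stabilizes B (c i)"
    using algebraic_ints_stabilize[of "c ` {..<d}"] assms(1) by auto
  from stabilizes_extend[OF B(1,2) _ z] show ?thesis
    using B(3) by (metis algebraic_int_if_stabilizes)
qed

section \<open>Polynomials with algebraic integer coefficients\<close>

definition Zbar_poly :: "complex poly \<Rightarrow> bool" where
  "Zbar_poly p \<longleftrightarrow> (\<forall>i. algebraic_int (coeff p i))"

lemma Zbar_poly_0 [simp]: "Zbar_poly 0"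
  and Zbar_poly_1 [simp]: "Zbar_poly 1"
  by (auto simp: Zbar_poly_def coeff_1)

lemma Zbar_poly_monom: "algebraic_int a \<Longrightarrow> Zbar_poly (monom a n)"
  by (auto simp: Zbar_poly_def)

lemma Zbar_poly_pCons: "Zbar_poly (pCons a p) \<longleftrightarrow> algebraic_int a \<and> Zbar_poly p"
  unfolding Zbar_poly_def
  by (metis coeff_pCons_0 coeff_pCons_Suc old.nat.exhaust)

lemma Zbar_poly_add: "Zbar_poly p \<Longrightarrow> Zbar_poly q \<Longrightarrow> Zbar_poly (p + q)"
  by (simp add: Zbar_poly_def algebraic_int_add)

lemma Zbar_poly_diff: "Zbar_poly p \<Longrightarrow> Zbar_poly q \<Longrightarrow> Zbar_poly (p - q)"
  by (simp add: Zbar_poly_def algebraic_int_diff)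

lemma Zbar_poly_mult: "Zbar_poly p \<Longrightarrow> Zbar_poly q \<Longrightarrow> Zbar_poly (p * q)"
  by (simp add: Zbar_poly_def coeff_mult algebraic_int_mult algebraic_int_sum)

lemma Zbar_poly_power: "Zbar_poly p \<Longrightarrow> Zbar_poly (p ^ n)"
  by (induction n) (auto intro: Zbar_poly_mult)

lemma Zbar_poly_smult: "algebraic_int a \<Longrightarrow> Zbar_poly p \<Longrightarrow> Zbar_poly (smult a p)"
  by (simp add: Zbar_poly_def algebraic_int_mult)

lemma Zbar_poly_sum: "(\<And>x. x \<in> X \<Longrightarrow> Zbar_poly (g x)) \<Longrightarrow> Zbar_poly (sum g X)"
  by (induction X rule: infinite_finite_induct) (auto intro: Zbar_poly_add)

lemma Zbar_poly_prod: "(\<And>x. x \<in> X \<Longrightarrow> Zbar_poly (g x)) \<Longrightarrow> Zbar_poly (prod g X)"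
  by (induction X rule: infinite_finite_induct) (auto intro: Zbar_poly_mult)

lemma Zbar_poly_pderiv: "Zbar_poly p \<Longrightarrow> Zbar_poly (pderiv p)"
  unfolding Zbar_poly_def coeff_pderiv
  by (auto intro!: algebraic_int_mult simp del: of_nat_Suc)

lemma algebraic_int_poly: "Zbar_poly p \<Longrightarrow> algebraic_int x \<Longrightarrow> algebraic_int (poly p x)"
  by (simp add: poly_altdef Zbar_poly_def algebraic_int_mult algebraic_int_power algebraic_int_sum)

lemma Zbar_poly_Ints: "\<forall>i. coeff p i \<in> \<int> \<Longrightarrow> Zbar_poly p"
  by (simp add: Zbar_poly_def int_imp_algebraic_int)

section \<open>Roots and monic factors of integral polynomials\<close>

text \<open>Multiplying the equation of \<open>r\<close> by \<open>a ^ (d - 1)\<close> turns it into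
  a monic equation for \<open>a * r\<close> with integral coefficients.\<close>

lemma algebraic_int_lead_coeff_mult_root:
  assumes "Zbar_poly p" "p \<noteq> 0" "poly p r = 0"
  shows "algebraic_int (lead_coeff p * r)"
proof -
  define a d where "a = lead_coeff p" and "d = degree p"
  have "d \<noteq> 0"
    using assms(2,3) by (auto simp: d_def elim!: degree_eq_zeroE)
  have "0 = (\<Sum>i<d. coeff p i * r ^ i) + a * r ^ d"
    using assms(3) unfolding poly_altdef lessThan_Suc_atMost[symmetric] by (simp add: a_def d_def)
  then have "a * r ^ d = - (\<Sum>i<d. coeff p i * r ^ i)"
    by (simp add: eq_neg_iff_add_eq_0 add.commute)
  then have "a ^ (d - 1) * (a * r ^ d) = a ^ (d - 1) * - (\<Sum>i<d. coeff p i * r ^ i)"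
    by (simp only:)
  also have "a ^ (d - 1) * (a * r ^ d) = (a * r) ^ d"
    using \<open>d \<noteq> 0\<close> by (cases d) (simp_all add: power_mult_distrib)
  also have "a ^ (d - 1) * - (\<Sum>i<d. coeff p i * r ^ i) =
      (\<Sum>i<d. (- coeff p i * a ^ (d - 1 - i)) * (a * r) ^ i)"
    unfolding sum_negf[symmetric] sum_distrib_left
  proof (rule sum.cong)
    fix i assume "i \<in> {..<d}"
    then have "a ^ (d - 1) = a ^ (d - 1 - i) * a ^ i"
      by (simp add: power_add[symmetric])
    then show "a ^ (d - 1) * - (coeff p i * r ^ i) = - coeff p i * a ^ (d - 1 - i) * (a * r) ^ i"
      by (simp add: power_mult_distrib)
  qed simp
  finally have "(a * r) ^ d = (\<Sum>i<d. (- coeff p i * a ^ (d - 1 - i)) * (a * r) ^ i)" .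
  then show ?thesis
    unfolding a_def[symmetric]
    by (rule algebraic_int_monic_root[rotated])
       (use assms(1) in \<open>auto simp: Zbar_poly_def a_def intro!: algebraic_int_mult algebraic_int_power\<close>)
qed

text \<open>The leading coefficient \<open>a\<close> of \<open>s\<close> is that of the product,
  hence integral, and so is \<open>a * r\<close> by the preceding lemma. Removing the top term of
  \<open>s\<close> thus changes the product by an integral polynomial, and induction on the degree
  applies.\<close>

lemma Zbar_poly_div_linear:
  assumes "Zbar_poly ([:-r, 1:] * s)"
  shows "Zbar_poly s"
  using assms
proof (induction "degree s" arbitrary: s rule: less_induct)
  case less
  show ?case
  proof (cases "s = 0")
    case False
    define a d p where "a = lead_coeff s" and "d = degree s" and "p = [:-r, 1:] * s"
    have p: "p \<noteq> 0" "lead_coeff p = a" "poly p r = 0"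
      using False unfolding p_def lead_coeff_mult by (auto simp: a_def mult_eq_0_iff simp del: mult_pCons_left)
    have a: "algebraic_int a"
      using less.prems p(2) unfolding p_def Zbar_poly_def by metis
    have ar: "algebraic_int (a * r)"
      using algebraic_int_lead_coeff_mult_root[OF _ p(1,3)] less.prems p(2) by (simp add: p_def)
    define s' where "s' = s - monom a d"
    have "Zbar_poly s'"
    proof (cases "s' = 0")
      case False
      have "degree s' < degree s"
      proof -
        have "degree s' \<le> d"
          unfolding s'_def by (rule degree_diff_le) (simp_all add: d_def degree_monom_le)
        moreover have "coeff s' d = 0"
          by (simp add: s'_def a_def d_def)
        ultimately show ?thesis
          using False unfolding d_def by (metis le_neq_implies_less leading_coeff_0_iff)
      qed
      moreover have "[:-r, 1:] * s' = p - monom a (Suc d) + monom (a * r) d"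
        by (simp add: s'_def p_def algebra_simps monom_Suc smult_monom smult_diff_right add_monom)
      then have "Zbar_poly ([:-r, 1:] * s')"
        using less.prems a ar unfolding p_def by (simp add: Zbar_poly_add Zbar_poly_diff Zbar_poly_monom)
      ultimately show ?thesis by (rule less.hyps)
    qed simp
    moreover have "s = s' + monom a d" by (simp add: s'_def)
    ultimately show ?thesis using a by (metis Zbar_poly_add Zbar_poly_monom)
  qed simp
qed

lemma complex_poly_linear_factor:
  fixes q :: "complex poly"
  assumes "degree q > 0"
  obtains r q' where "q = [:-r, 1:] * q'" "degree q' < degree q" "q' \<noteq> 0" "lead_coeff q' = lead_coeff q"
proof -
  obtain r where "poly q r = 0"
    using alg_closed_imp_poly_has_root[OF assms] by blast
  then obtain q' where q': "q = [:-r, 1:] * q'"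
    by (auto simp: poly_eq_0_iff_dvd elim: dvdE)
  have "q' \<noteq> 0" using assms q' by auto
  then have "degree q = Suc (degree q')"
    unfolding q' by (subst degree_mult_eq) auto
  moreover have "lead_coeff q' = lead_coeff q"
    unfolding q' lead_coeff_mult by simp
  ultimately show ?thesis using that q' \<open>q' \<noteq> 0\<close> by simp
qed

text \<open>The monic factor splits over the complex numbers, and its linear factors are cancelled
  one by one.\<close>

lemma Zbar_poly_monic_factor:
  assumes "Zbar_poly (p * q)" "lead_coeff q = 1"
  shows "Zbar_poly p"
  using assms
proof (induction "degree q" arbitrary: q rule: less_induct)
  case less
  show ?case
  proof (cases "degree q = 0")
    case True
    then have "q = 1"
      using less.prems(2) by (metis degree_0_id one_pCons)
    then show ?thesis using less.prems(1) by simp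
  next
    case False
    then obtain r q' where q': "q = [:-r, 1:] * q'" "degree q' < degree q" "lead_coeff q' = lead_coeff q"
      using complex_poly_linear_factor by blast
    have "Zbar_poly ([:-r, 1:] * (p * q'))"
      using less.prems(1) unfolding q'(1) by (simp only: mult.left_commute)
    from less.hyps[OF q'(2) Zbar_poly_div_linear[OF this]] show ?thesis
      using less.prems q' by simp
  qed
qed

section \<open>Integer multiples of algebraic numbers and polynomials\<close>

text \<open>An integer equation \<open>a + c * poly p c = 0\<close> with nonzero \<open>a\<close>
  exhibits \<open>- poly p c\<close> as the cofactor; a vanishing constant term is divided out
  first.\<close>

lemma algebraic_int_divides_int:
  fixes c :: complex
  assumes "algebraic_int c" "c \<noteq> 0"
  obtains w t where "algebraic_int w" "t \<noteq> 0" "c * w = of_int t"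
proof -
  have "\<exists>w t. algebraic_int w \<and> t \<noteq> 0 \<and> c * w = of_int t"
    if "\<forall>i. coeff p i \<in> \<int>" "p \<noteq> 0" "poly p c = 0" for p
    using that
  proof (induction p)
    case (pCons a p)
    have p: "\<forall>i. coeff p i \<in> \<int>" and a: "a \<in> \<int>"
      using pCons.prems(1) by (metis coeff_pCons_Suc, metis coeff_pCons_0)
    show ?case
    proof (cases "a = 0")
      case True
      with pCons.prems assms have "poly p c = 0" "p \<noteq> 0" by auto
      with pCons.IH p show ?thesis by blast
    next
      case False
      obtain t where t: "a = of_int t" using a by (auto elim: Ints_cases)
      have "algebraic_int (- poly p c)"
        using algebraic_int_poly[OF Zbar_poly_Ints[OF p] assms(1)] by simp
      moreover have "c * - poly p c = of_int t"
        using pCons.prems(3) t by (simp add: eq_neg_iff_add_eq_0[symmetric])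
      ultimately show ?thesis using False t by auto
    qed
  qed simp
  moreover obtain p where "lead_coeff p = 1" "\<forall>i. coeff p i \<in> \<int>" "poly p c = 0"
    using assms(1) by (auto elim: algebraic_int.cases)
  moreover from this have "p \<noteq> 0" by auto
  ultimately show ?thesis using that by blast
qed

lemma algebraic_int_multiple:
  fixes x :: complex
  assumes "algebraic x"
  obtains t :: int where "t \<noteq> 0" "algebraic_int (of_int t * x)"
proof -
  obtain p where p: "\<forall>i. coeff p i \<in> \<int>" "p \<noteq> 0" "poly p x = 0"
    using assms by (auto simp: algebraic_def)
  obtain t where t: "lead_coeff p = of_int t"
    using p(1) by (metis Ints_cases)
  have "algebraic_int (of_int t * x)"
    using algebraic_int_lead_coeff_mult_root[OF Zbar_poly_Ints[OF p(1)] p(2,3)] t by simp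
  with that t p(2) show ?thesis by (metis leading_coeff_0_iff of_int_0)
qed

lemma algebraic_if_int_multiple:
  fixes x :: complex
  assumes "t \<noteq> 0" "algebraic_int (of_int t * x)"
  shows "algebraic x"
proof -
  obtain p where p: "lead_coeff p = 1" "\<forall>i. coeff p i \<in> \<int>" "poly p (of_int t * x) = 0"
    using assms(2) by (auto elim: algebraic_int.cases)
  define q where "q = pcompose p [:0, of_int t:]"
  have "\<forall>i. coeff q i \<in> \<int>"
    unfolding q_def using p(2)
    by (intro allI coeff_pcompose_semiring_closed) (auto simp: coeff_pCons split: nat.splits)
  moreover have "poly q x = 0"
    using p(3) by (simp add: q_def poly_pcompose mult.commute)
  moreover have "q \<noteq> 0"
    using p(1) assms(1) unfolding q_def by (subst pcompose_eq_0_iff) auto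
  ultimately show ?thesis unfolding algebraic_def by blast
qed

lemma Zbar_poly_multiple:
  assumes "\<forall>i. algebraic (coeff p i)"
  shows "\<exists>t::int. t \<noteq> 0 \<and> Zbar_poly (smult (of_int t) p)"
  using assms
proof (induction p)
  case (pCons a p)
  have "\<forall>i. algebraic (coeff p i)" "algebraic a"
    using pCons.prems by (metis coeff_pCons_Suc, metis coeff_pCons_0)
  with pCons.IH obtain t u :: int where t: "t \<noteq> 0" "Zbar_poly (smult (of_int t) p)"
    and u: "u \<noteq> 0" "algebraic_int (of_int u * a)"
    using algebraic_int_multiple by metis
  have "Zbar_poly (smult (of_int u) (smult (of_int t) p))" "algebraic_int (of_int t * (of_int u * a))"
    by (rule Zbar_poly_smult[OF _ t(2)], simp) (rule algebraic_int_mult[OF _ u(2)], simp)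
  then show ?case using t(1) u(1)
    by (intro exI[of _ "t * u"]) (simp add: Zbar_poly_pCons mult_ac)
qed (auto intro!: exI[of _ 1])

lemma Ints_coeff_mult:
  fixes p q :: "complex poly"
  assumes "\<forall>i. coeff p i \<in> \<int>" "\<forall>i. coeff q i \<in> \<int>"
  shows "\<forall>i. coeff (p * q) i \<in> \<int>"
  using assms by (auto simp: coeff_mult intro!: Ints_sum Ints_mult)

text \<open>Replaces the norm: every root \<open>r\<close> of \<open>E\<close> is a root of an
  integer polynomial \<open>A\<close>, and an integral cofactor completes the linear factor at
  \<open>r\<close> to \<open>A\<close>. The remaining constant is completed to an integer.\<close>

lemma Zbar_poly_divides_int_poly:
  assumes "Zbar_poly E" "E \<noteq> 0"
  shows "\<exists>G. Zbar_poly G \<and> G \<noteq> 0 \<and> (\<forall>i. coeff (E * G) i \<in> \<int>)"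
  using assms
proof (induction "degree E" arbitrary: E rule: less_induct)
  case less
  show ?case
  proof (cases "degree E = 0")
    case True
    then obtain c where c: "E = [:c:]" by (metis degree_0_id)
    with less.prems have "algebraic_int c" "c \<noteq> 0" by (auto simp: Zbar_poly_pCons)
    then obtain w t where wt: "algebraic_int w" "t \<noteq> 0" "c * w = of_int t"
      using algebraic_int_divides_int by blast
    then have "Zbar_poly [:w:]" "[:w:] \<noteq> 0" "\<forall>i. coeff (E * [:w:]) i \<in> \<int>"
      by (auto simp: c Zbar_poly_pCons coeff_pCons mult.commute[of w c] split: nat.splits)
    then show ?thesis by blast
  next
    case False
    then obtain r E' where E': "E = [:-r, 1:] * E'" "degree E' < degree E" "E' \<noteq> 0"
      using complex_poly_linear_factor by blast
    have "Zbar_poly E'"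
      using less.prems(1) unfolding E'(1) by (rule Zbar_poly_div_linear)
    from less.hyps[OF E'(2) this E'(3)] obtain G where
      G: "Zbar_poly G" "G \<noteq> 0" "\<forall>i. coeff (E' * G) i \<in> \<int>" by blast
    define a where "a = lead_coeff E"
    have a: "algebraic_int a" "a \<noteq> 0"
      using less.prems by (auto simp: a_def Zbar_poly_def)
    have ar: "algebraic_int (a * r)"
      unfolding a_def using less.prems by (intro algebraic_int_lead_coeff_mult_root) (auto simp: E'(1))
    obtain w t where wt: "algebraic_int w" "t \<noteq> 0" "a * w = of_int t"
      using algebraic_int_divides_int[OF a] by blast
    have "algebraic_int (of_int t * r)"
      using algebraic_int_mult[OF wt(1) ar] unfolding wt(3)[symmetric] by (simp only: mult_ac)
    with wt(2) have "algebraic r" by (rule algebraic_if_int_multiple)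
    then obtain A where A: "\<forall>i. coeff A i \<in> \<int>" "A \<noteq> 0" "poly A r = 0"
      by (auto simp: algebraic_def)
    then obtain s where s: "A = [:-r, 1:] * s"
      by (auto simp: poly_eq_0_iff_dvd elim: dvdE)
    have "Zbar_poly s"
      using Zbar_poly_Ints[OF A(1)] unfolding s by (rule Zbar_poly_div_linear)
    moreover have "E * (s * G) = A * (E' * G)"
      unfolding E'(1) s by (simp only: mult_ac)
    then have "\<forall>i. coeff (E * (s * G)) i \<in> \<int>"
      using Ints_coeff_mult[OF A(1) G(3)] by metis
    ultimately show ?thesis
      using G A(2) s by (intro exI[of _ "s * G"]) (auto intro: Zbar_poly_mult)
  qed
qed

section \<open>Multiples of powers\<close>

abbreviation ieval :: "complex \<Rightarrow> int poly \<Rightarrow> complex" where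
  "ieval x P \<equiv> poly (map_poly of_int P) x"

lemma ieval_simps [simp]:
  "ieval x 1 = 1"
  "ieval x (P + Q) = ieval x P + ieval x Q"
  "ieval x (P - Q) = ieval x P - ieval x Q"
  "ieval x (P * Q) = ieval x P * ieval x Q"
  "ieval x (P ^ n) = ieval x P ^ n"
  "ieval x (smult c P) = of_int c * ieval x P"
  "ieval x (monom c n) = of_int c * x ^ n"
  by (simp_all add: hom_distribs poly_monom)

lemma ieval_const [simp]: "ieval x [:c:] = of_int c"
  using ieval_simps(7)[where x = x and c = c and n = 0] by (simp add: monom_0 del: ieval_simps)

lemma ieval_sum: "ieval x (sum g X) = (\<Sum>y\<in>X. ieval x (g y))"
  by (induction X rule: infinite_finite_induct) auto

text \<open>
  \<open>Q\<close> is the homogenization of the monic integral equation of \<open>c\<close>, evaluated at \<open>A\<close> and \<open>B\<close>.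
\<close>
lemma homogenized_relation:
  assumes "algebraic_int c" "ieval x A = c * ieval x B"
  obtains Q d where "ieval x Q = 0" "coeff B 0 dvd coeff Q 0 - coeff A 0 ^ d"
proof -
  obtain g :: "int poly" where g: "poly (map_poly of_int g) c = 0" "lead_coeff g = 1"
    using assms(1) by (auto simp: algebraic_int_altdef_ipoly)
  define d where "d = degree g"
  define Q where "Q = (\<Sum>j\<le>d. smult (coeff g j) (A ^ j * B ^ (d - j)))"
  have "ieval x Q = (\<Sum>j\<le>d. of_int (coeff g j) * (ieval x A ^ j * ieval x B ^ (d - j)))"
    by (simp add: Q_def ieval_sum)
  also have "\<dots> = (\<Sum>j\<le>d. ieval x B ^ d * (of_int (coeff g j) * c ^ j))"
    by (rule sum.cong) (auto simp: assms(2) power_mult_distrib power_add[symmetric])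
  also have "\<dots> = ieval x B ^ d * poly (map_poly of_int g) c"
    by (simp add: poly_altdef sum_distrib_left d_def)
  finally have "ieval x Q = 0" using g by simp
  moreover have "coeff Q 0 - coeff A 0 ^ d =
      (\<Sum>j<d. coeff g j * (coeff A 0 ^ j * coeff B 0 ^ (d - j)))"
    unfolding Q_def using g(2)
    by (simp add: lessThan_Suc_atMost[symmetric] coeff_mult_0 coeff_0_power coeff_sum d_def)
  moreover have "coeff B 0 dvd \<dots>"
    by (rule dvd_sum) (auto intro!: dvd_mult dvd_power)
  ultimately show ?thesis using that by metis
qed

text \<open>Least positive element and division with remainder; \<open>t = 0\<close> is the zero
  ideal.\<close>

lemma int_ideal_principal:
  fixes T :: "int set"
  assumes "0 \<in> T" "\<And>u v k. u \<in> T \<Longrightarrow> v \<in> T \<Longrightarrow> u - k * v \<in> T"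
  obtains t where "t \<in> T" "t \<ge> 0" "\<And>u. u \<in> T \<Longrightarrow> t dvd u"
proof (cases "T \<subseteq> {0}")
  case True
  then show ?thesis using that[of 0] assms(1) by auto
next
  case False
  then obtain u where u: "u \<in> T" "u \<noteq> 0" by auto
  have "- u \<in> T" using assms(2)[OF assms(1) u(1), of 1] by simp
  with u have "int (nat \<bar>u\<bar>) \<in> T \<and> nat \<bar>u\<bar> > 0" by (auto simp: abs_if)
  define n where "n = (LEAST n. int n \<in> T \<and> n > 0)"
  have n: "int n \<in> T \<and> n > 0"
    unfolding n_def by (rule LeastI) fact
  have "int n dvd v" if "v \<in> T" for v
  proof (rule ccontr)
    assume "\<not> int n dvd v"
    then have "v mod int n > 0"
      using n by (metis dvd_eq_mod_eq_0 of_nat_0_less_iff order_le_neq_trans pos_mod_sign)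
    moreover have "v mod int n \<in> T"
      using assms(2)[OF that, of "int n" "v div int n"] n by (simp add: minus_div_mult_eq_mod)
    moreover have "nat (v mod int n) < n"
      using n by (simp add: nat_less_iff)
    ultimately show False
      using not_less_Least[of "nat (v mod int n)" "\<lambda>n. int n \<in> T \<and> n > 0"] by (simp add: n_def)
  qed
  with n that[of "int n"] show ?thesis by simp
qed

text \<open>
  Equivalently, \<open>x\<close> is not a unit of \<open>\<int>[x]\<close>, so \<open>x \<mapsto> 0\<close> defines a ring homomorphism from \<open>\<int>[x]\<close> to a
  prime field. It stands in for a valuation at which \<open>1 / x\<close> has a pole.
\<close>
lemma prime_dvd_constant_coeffs:
  assumes "\<not> algebraic_int (inverse x)"
  obtains p :: int where "prime p" "\<And>P. ieval x P = 0 \<Longrightarrow> p dvd coeff P 0"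
proof -
  let ?T = "{coeff P 0 | P. ieval x P = 0}"
  obtain t where t: "t \<in> ?T" "t \<ge> 0" "\<And>u. u \<in> ?T \<Longrightarrow> t dvd u"
  proof (rule int_ideal_principal)
    show "0 \<in> ?T" by (auto intro!: exI[of _ 0])
    show "u - k * v \<in> ?T" if "u \<in> ?T" "v \<in> ?T" for u v k
    proof -
      from that obtain P Q where "u = coeff P 0" "v = coeff Q 0" "ieval x P = 0" "ieval x Q = 0"
        by auto
      then show ?thesis
        by (auto intro!: exI[of _ "P + smult (- k) Q"])
    qed
  qed blast
  from t(1) obtain P where P: "ieval x P = 0" "coeff P 0 = t" by blast
  have "t \<noteq> 1"
  proof
    assume "t = 1"
    \<comment> \<open>The reversed polynomial of \<open>P\<close> is monic and vanishes at
      \<open>inverse x\<close>.\<close>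
    with P have "algebraic_int (inverse x)"
      by (intro algebraic_int_inverse[of "map_poly of_int P"]) (auto simp: coeff_map_poly)
    with assms show False by simp
  qed
  \<comment> \<open>If \<open>t = 0\<close>, every prime will do.\<close>
  with t(2) obtain p where "prime p" "p dvd t"
    by (metis prime_factor_int abs_of_nonneg)
  moreover have "t dvd coeff P 0" if "ieval x P = 0" for P
    using t(3) that by auto
  ultimately show ?thesis using that by (meson dvd_trans)
qed

section \<open>Numbers whose powers have multiples of polynomial growth that are integral\<close>

lemma poly_eventually_less_two_power:
  fixes Q :: "complex poly"
  shows "eventually (\<lambda>n. norm (poly Q (of_nat n)) < 2 ^ n) sequentially"
proof -
  have "(\<lambda>n. (\<Sum>i\<le>degree Q. norm (coeff Q i) * (real n ^ i / 2 ^ n))) \<longlonglongrightarrow> (\<Sum>i\<le>degree Q. norm (coeff Q i) * 0)"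
    by (intro tendsto_intros) real_asymp
  then have "eventually (\<lambda>n. (\<Sum>i\<le>degree Q. norm (coeff Q i) * (real n ^ i / 2 ^ n)) < 1) sequentially"
    by (rule order_tendstoD) simp
  then show ?thesis
  proof eventually_elim
    case (elim n)
    have "norm (poly Q (of_nat n)) \<le> (\<Sum>i\<le>degree Q. norm (coeff Q i) * real n ^ i)"
      unfolding poly_altdef by (rule order_trans[OF norm_sum]) (simp add: norm_mult norm_power)
    also have "\<dots> = (\<Sum>i\<le>degree Q. norm (coeff Q i) * (real n ^ i / 2 ^ n)) * 2 ^ n"
      by (simp add: sum_distrib_right)
    also have "\<dots> < 1 * 2 ^ n"
      by (rule mult_strict_right_mono[OF elim]) simp
    finally show ?case by simp
  qed
qed

text \<open>If \<open>b\<close> is not integral, \<open>1 / b\<close> maps to 0 in some field of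
  prime order \<open>p\<close>. Integrality of the multiples of \<open>b ^ n\<close> then forces the
  exponent of \<open>p\<close> in the values of \<open>Z\<close> to grow linearly with
  \<open>n\<close>, while these values grow only polynomially.\<close>

lemma algebraic_int_base_if_powers:
  fixes b :: complex
  assumes Z: "\<forall>i. coeff Z i \<in> \<int>" "Z \<noteq> 0" and "infinite S"
    and int: "\<And>n. n \<in> S \<Longrightarrow> algebraic_int (poly Z (of_nat n) * b ^ n)"
  shows "algebraic_int b"
proof (rule ccontr)
  assume b: "\<not> algebraic_int b"
  then have "b \<noteq> 0" by auto
  define x where "x = inverse b"
  have x: "x \<noteq> 0" "inverse x = b" using \<open>b \<noteq> 0\<close> by (auto simp: x_def)
  obtain p :: int where p: "prime p" "\<And>P. ieval x P = 0 \<Longrightarrow> p dvd coeff P 0"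
    using prime_dvd_constant_coeffs[of x] b x by auto
  have "\<exists>N::int. poly Z (of_nat n) = of_int N" for n
  proof -
    have "poly Z (of_nat n) \<in> \<int>"
      unfolding poly_altdef using Z(1) by (intro Ints_sum Ints_mult Ints_power) auto
    then show ?thesis by (auto elim: Ints_cases)
  qed
  then obtain N :: "nat \<Rightarrow> int" where N: "\<And>n. poly Z (of_nat n) = of_int (N n)" by metis
  have "finite {n :: nat. poly Z (of_nat n) = 0}"
  proof (rule finite_subset)
    show "{n. poly Z (of_nat n) = 0} \<subseteq> of_nat -` {z. poly Z z = 0}" by auto
    show "finite (of_nat -` {z. poly Z z = 0} :: nat set)"
      by (intro finite_vimageI poly_roots_finite Z(2)) (simp add: inj_def)
  qed
  then have "finite ({n. poly Z (of_nat n) = 0} \<union> {0})" by simp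
  then have "infinite (S - ({n. poly Z (of_nat n) = 0} \<union> {0}))"
    using \<open>infinite S\<close> by (rule Diff_infinite_finite)
  define S' where "S' = S - ({n. poly Z (of_nat n) = 0} \<union> {0})"
  have inf: "infinite S'" unfolding S'_def by fact
  have S': "algebraic_int (of_int (N n) * b ^ n)" "N n \<noteq> 0" "n \<noteq> 0" if "n \<in> S'" for n
    using int[of n] that N[of n] by (auto simp: S'_def)

  \<comment> \<open>A single exponent makes \<open>x\<close> algebraic: \<open>N n\<close> is an
    integral multiple of \<open>x ^ n\<close>, and homogenizing gives a relation with nonzero
    constant term \<open>N n ^ d\<close>. Its primitive part has a coefficient prime to
    \<open>p\<close>.\<close>
  obtain C where C: "ieval x C = 0" "\<exists>i. \<not> p dvd coeff C i"
  proof -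
    obtain n where n: "n \<in> S'" using inf by (metis finite.emptyI ex_in_conv)
    have "ieval x [:N n:] = (of_int (N n) * b ^ n) * ieval x (monom 1 n)"
      by (simp add: x_def \<open>b \<noteq> 0\<close> power_inverse map_poly_pCons poly_monom)
    from homogenized_relation[OF S'(1)[OF n] this] obtain Q d where
      Q: "ieval x Q = 0" "coeff (monom 1 n) 0 dvd coeff Q 0 - coeff [:N n:] 0 ^ d" .
    then have "coeff Q 0 = N n ^ d" using S'(3)[OF n] by simp
    then have "Q \<noteq> 0" using S'(2)[OF n] by auto
    have "ieval x (primitive_part Q) = 0"
    proof -
      have "of_int (content Q) * ieval x (primitive_part Q) = 0"
        using Q(1) by (metis ieval_simps(6) content_times_primitive_part)
      then show ?thesis using \<open>Q \<noteq> 0\<close> by simp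
    qed
    moreover have "\<exists>i. \<not> p dvd coeff (primitive_part Q) i"
    proof (rule ccontr)
      assume "\<not> ?thesis"
      then have "p dvd content (primitive_part Q)"
        by (simp add: const_poly_dvd_iff_dvd_content[symmetric] const_poly_dvd_iff)
      then show False using p(1) \<open>Q \<noteq> 0\<close> not_prime_unit[of p] by simp
    qed
    ultimately show ?thesis by (rule that)
  qed
  \<comment> \<open>The coefficients of \<open>C\<close> below index \<open>r\<close> are divisible
    by \<open>p\<close>, so \<open>C\<close> splits as \<open>monom 1 r * U + smult p W\<close> with
    \<open>coeff U 0\<close> prime to \<open>p\<close>. Thus \<open>x ^ r\<close> behaves like a
    multiple of \<open>p\<close>.\<close>
  define r where "r = (LEAST i. \<not> p dvd coeff C i)"
  have r: "\<not> p dvd coeff C r" "\<And>i. i < r \<Longrightarrow> p dvd coeff C i"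
    unfolding r_def using C(2) by (metis LeastI_ex, metis not_less_Least)
  have "r > 0" using r(1) p(2)[OF C(1)] by (cases r) auto
  define U where "U = poly_shift r C"
  obtain W where W: "poly_cutoff r C = smult p W"
  proof -
    have "[:p:] dvd poly_cutoff r C"
      unfolding const_poly_dvd_iff using r(2) by (auto simp: coeff_poly_cutoff)
    then show ?thesis using that by (auto elim!: dvdE)
  qed
  have U0: "coeff U 0 = coeff C r" by (simp add: U_def coeff_poly_shift)
  have "C = monom 1 r * U + smult p W"
    unfolding W[symmetric] U_def
    by (rule poly_eqI) (auto simp: coeff_monom_mult coeff_poly_shift coeff_poly_cutoff)
  from arg_cong[OF this, of "ieval x"] C(1) have "x ^ r * ieval x U + of_int p * ieval x W = 0"
    by (simp add: poly_monom)
  then have xU: "x ^ r * ieval x U = - of_int p * ieval x W"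
    by (simp add: eq_neg_iff_add_eq_0)

  have bound: "2 ^ n < norm (2 * poly Z (of_nat n)) ^ r" if n: "n \<in> S'" for n
  proof -
    define s where "s = multiplicity p (N n)"
    obtain N' where N': "N n = p ^ s * N'" "\<not> p dvd N'"
      unfolding s_def
      using multiplicity_decompose'[of "N n" p] S'(2)[OF n] p(1) by (metis not_prime_unit)
    have "n < r * Suc s"
    proof (rule ccontr)
      assume "\<not> ?thesis"
      then obtain m where m: "n = m + r * Suc s" by (metis add.commute le_Suc_ex not_less)
      \<comment> \<open>For \<open>n \<ge> r * Suc s\<close>, the power \<open>x ^ n\<close>
        supplies \<open>Suc s\<close> factors \<open>p\<close>, one more than \<open>N n\<close>
        has. Cancelling \<open>p ^ s\<close> makes the value of \<open>A\<close> at \<open>x\<close>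
        an integral multiple of that of \<open>B\<close>, although \<open>p\<close> divides the
        constant term of \<open>B\<close> and not that of \<open>A\<close>.\<close>
      define A where "A = smult N' (U ^ Suc s)"
      define B where "B = smult p (monom 1 m * (- W) ^ Suc s)"
      have "x ^ n * ieval x U ^ Suc s = x ^ m * (x ^ r * ieval x U) ^ Suc s"
        unfolding m power_add power_mult power_mult_distrib by (simp only: mult_ac)
      also have "\<dots> = of_int p ^ Suc s * (x ^ m * (- ieval x W) ^ Suc s)"
        unfolding xU minus_mult_commute power_mult_distrib by (simp only: mult_ac)
      also have "\<dots> = of_int p ^ s * ieval x B"
        by (simp add: B_def hom_distribs poly_monom)
      finally have *: "x ^ n * ieval x U ^ Suc s = of_int p ^ s * ieval x B" .
      have "of_int p ^ s * ieval x A = of_int (N n) * ieval x U ^ Suc s"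
        by (simp add: A_def N')
      also have "\<dots> = (of_int (N n) * b ^ n) * (x ^ n * ieval x U ^ Suc s)"
        by (simp add: x_def \<open>b \<noteq> 0\<close> power_inverse)
      also have "\<dots> = of_int p ^ s * ((of_int (N n) * b ^ n) * ieval x B)"
        unfolding * by (simp only: mult_ac)
      finally have "ieval x A = (of_int (N n) * b ^ n) * ieval x B"
        using p(1) by simp
      from homogenized_relation[OF S'(1)[OF n] this] obtain Q d where
        Q: "ieval x Q = 0" "coeff B 0 dvd coeff Q 0 - coeff A 0 ^ d" .
      have "p dvd coeff B 0" by (simp add: B_def)
      with Q(2) p(2)[OF Q(1)] have "p dvd coeff A 0 ^ d"
        by (meson dvd_trans dvd_diff_commute dvd_diffD1 zdvd_zdiffD)
      then have "p dvd N' * coeff C r ^ Suc s"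
        using prime_dvd_power[OF p(1)]
        by (simp add: A_def U0 coeff_0_power del: power_Suc)
      then show False
        using N'(2) r(1) prime_dvd_mult_iff[OF p(1)] prime_dvd_power[OF p(1)] by blast
    qed
    then have "(2::real) ^ n < 2 ^ (r * Suc s)" by simp
    also have "\<dots> = (2 * 2 ^ s) ^ r"
      unfolding power_Suc[symmetric] power_mult[symmetric] by (simp only: mult.commute)
    also have "\<dots> \<le> (2 * \<bar>real_of_int (N n)\<bar>) ^ r"
    proof (intro power_mono mult_left_mono)
      have "(2::int) ^ s \<le> p ^ s"
        using prime_ge_2_int[OF p(1)] by (intro power_mono) auto
      also have "\<dots> \<le> \<bar>N n\<bar>"
        using N' S'(2)[OF n] by (metis dvd_imp_le_int dvd_triv_left abs_of_nonneg p(1) prime_ge_0_int zero_le_power)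
      finally show "2 ^ s \<le> \<bar>real_of_int (N n)\<bar>" by (metis of_int_abs of_int_le_iff of_int_numeral of_int_power)
    qed auto
    also have "\<dots> = norm (2 * poly Z (of_nat n)) ^ r"
      by (simp add: N norm_mult)
    finally show ?thesis .
  qed
  have "eventually (\<lambda>n. norm (poly ((smult 2 Z) ^ r) (of_nat n)) < 2 ^ n) sequentially"
    by (rule poly_eventually_less_two_power)
  then obtain n0 where n0: "\<And>n. n \<ge> n0 \<Longrightarrow> norm (poly ((smult 2 Z) ^ r) (of_nat n)) < 2 ^ n"
    by (auto simp: eventually_sequentially)
  obtain n where "n \<in> S'" "n \<ge> n0" using inf by (metis infinite_nat_iff_unbounded_le)
  with bound[of n] n0[of n] show False
    by (simp add: norm_power norm_mult poly_power)
qed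

section \<open>From numbers to polynomials\<close>

text \<open>The coefficients of \<open>f\<close> are sums of products of its leading coefficient
  with negated roots, and these products are the constant coefficients of such \<open>g\<close>. The
  induction splits \<open>f = (x - r) f'\<close> into \<open>x f'\<close> and \<open>- r f'\<close>;
  the hypothesis passes to \<open>f'\<close> and to \<open>- r f'\<close>.\<close>

lemma Zbar_polyI_constant_coeffs:
  assumes "\<And>g h. f = g * h \<Longrightarrow> lead_coeff h = 1 \<Longrightarrow> algebraic_int (coeff g 0)"
  shows "Zbar_poly f"
  using assms
proof (induction "degree f" arbitrary: f rule: less_induct)
  case less
  show ?case
  proof (cases "degree f = 0")
    case True
    then obtain c where c: "f = [:c:]" by (metis degree_0_id)
    then show ?thesis using less.prems[of f 1] by (simp add: Zbar_poly_pCons)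
  next
    case False
    then obtain r f' where f': "f = [:-r, 1:] * f'" "degree f' < degree f"
      using complex_poly_linear_factor by blast
    have "Zbar_poly f'"
    proof (rule less.hyps[OF f'(2)])
      fix g h assume "f' = g * h" "lead_coeff h = 1"
      then have "f = g * ([:-r, 1:] * h)" "lead_coeff ([:-r, 1:] * h) = 1"
        unfolding f' lead_coeff_mult by (simp_all only: mult_ac) simp
      then show "algebraic_int (coeff g 0)" by (rule less.prems)
    qed
    moreover have "Zbar_poly (smult (- r) f')"
    proof (cases "r = 0")
      case False
      show ?thesis
      proof (rule less.hyps)
        show "degree (smult (- r) f') < degree f"
          using f'(2) degree_smult_le[of "- r" f'] by linarith
        fix g h assume gh: "smult (- r) f' = g * h" "lead_coeff h = 1"
        \<comment> \<open>The factor \<open>- 1 / r\<close> compensates for the constant term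
          \<open>- r\<close> of the linear factor, so the constant coefficient of \<open>g\<close>
          survives unchanged.\<close>
        have "f = smult (- 1 / r) ([:-r, 1:] * smult (- r) f')"
          using False unfolding f' by simp
        also have "\<dots> = (smult (- 1 / r) ([:-r, 1:] * g)) * h"
          unfolding gh by (simp only: mult.assoc mult_smult_left)
        finally have "algebraic_int (coeff (smult (- 1 / r) ([:-r, 1:] * g)) 0)"
          using gh(2) by (rule less.prems)
        then show "algebraic_int (coeff g 0)" using False by simp
      qed
    qed simp
    moreover have "f = pCons 0 f' + smult (- r) f'"
      by (simp add: f'(1))
    ultimately show ?thesis
      by (simp only: Zbar_poly_add Zbar_poly_pCons algebraic_int_0)
  qed
qed

text \<open>The outer variable stands for the exponent \<open>n\<close>, the inner one is \<open>x\<close>.\<close>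
definition Zbar_poly2 :: "complex poly poly \<Rightarrow> bool" where
  "Zbar_poly2 C \<longleftrightarrow> (\<forall>i. Zbar_poly (coeff C i))"

lemma Zbar_poly2_0: "Zbar_poly2 0"
  by (simp add: Zbar_poly2_def)

lemma Zbar_poly2_add: "Zbar_poly2 p \<Longrightarrow> Zbar_poly2 q \<Longrightarrow> Zbar_poly2 (p + q)"
  by (simp add: Zbar_poly2_def Zbar_poly_add)

lemma Zbar_poly2_diff: "Zbar_poly2 p \<Longrightarrow> Zbar_poly2 q \<Longrightarrow> Zbar_poly2 (p - q)"
  by (simp add: Zbar_poly2_def Zbar_poly_diff)

lemma Zbar_poly2_mult: "Zbar_poly2 p \<Longrightarrow> Zbar_poly2 q \<Longrightarrow> Zbar_poly2 (p * q)"
  by (simp add: Zbar_poly2_def coeff_mult Zbar_poly_mult Zbar_poly_sum)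

lemma Zbar_poly2_smult: "Zbar_poly a \<Longrightarrow> Zbar_poly2 p \<Longrightarrow> Zbar_poly2 (smult a p)"
  by (simp add: Zbar_poly2_def Zbar_poly_mult)

lemma Zbar_poly2_pCons: "Zbar_poly a \<Longrightarrow> Zbar_poly2 p \<Longrightarrow> Zbar_poly2 (pCons a p)"
  by (auto simp: Zbar_poly2_def coeff_pCons split: nat.splits)

lemma Zbar_poly2_pderiv: "Zbar_poly2 p \<Longrightarrow> Zbar_poly2 (map_poly pderiv p)"
  by (auto simp: Zbar_poly2_def coeff_map_poly Zbar_poly_pderiv)

lemma Zbar_poly2_poly:
  assumes "Zbar_poly2 C" "Zbar_poly x"
  shows "Zbar_poly (poly C x)"
  using assms unfolding poly_altdef Zbar_poly2_def
  by (auto intro!: Zbar_poly_sum Zbar_poly_mult Zbar_poly_power)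

lemma Zbar_poly_of_nat: "Zbar_poly [:of_nat n:]"
  by (simp add: Zbar_poly_pCons)

lemma coeff_poly_const: "coeff (poly C [:x:]) j = poly (map_poly (\<lambda>p. coeff p j) C) x"
  by (induction C) (auto simp: map_poly_pCons)

text \<open>\<open>D\<close> is the largest degree in the inner variable and \<open>E\<close> the
  coefficient there, a polynomial in the outer one. Away from the zeros of \<open>E\<close>,
  specializations have degree exactly \<open>D\<close> and leading coefficient
  \<open>poly E x\<close>.\<close>

lemma leading_slice:
  fixes C :: "complex poly poly"
  assumes "C \<noteq> 0"
  obtains D E where "E \<noteq> 0" "\<And>x. degree (poly C [:x:]) \<le> D" "\<And>x. coeff (poly C [:x:]) D = poly E x"
    "Zbar_poly2 C \<Longrightarrow> Zbar_poly E"
proof -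
  let ?s = "\<lambda>j. map_poly (\<lambda>p. coeff p j) C"
  let ?J = "{j. ?s j \<noteq> 0}"
  have "?J \<subseteq> (\<Union>i\<le>degree C. {..degree (coeff C i)})"
  proof
    fix j assume "j \<in> ?J"
    then have "?s j \<noteq> 0" by simp
    then obtain i where "coeff (coeff C i) j \<noteq> 0"
      by (metis coeff_map_poly coeff_0 poly_eqI)
    then have "j \<le> degree (coeff C i)" "i \<le> degree C"
      by (auto intro: le_degree simp: le_degree)
    then show "j \<in> (\<Union>i\<le>degree C. {..degree (coeff C i)})" by auto
  qed
  then have fin: "finite ?J" by (rule finite_subset) simp
  have "?s (degree (lead_coeff C)) \<noteq> 0"
  proof
    assume "?s (degree (lead_coeff C)) = 0"
    from arg_cong[OF this, of "\<lambda>p. coeff p (degree C)"] have "lead_coeff (lead_coeff C) = 0"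
      by (simp add: coeff_map_poly)
    with assms show False by simp
  qed
  then have "?J \<noteq> {}" by blast
  define D where "D = Max ?J"
  have D: "?s D \<noteq> 0" using Max_in[OF fin \<open>?J \<noteq> {}\<close>] by (simp add: D_def)
  show ?thesis
  proof
    show "?s D \<noteq> 0" by (rule D)
    show "degree (poly C [:x:]) \<le> D" for x
    proof (rule degree_le, intro allI impI)
      fix j assume "D < j"
      then have "?s j = 0" using Max_ge[OF fin, of j] unfolding D_def by fastforce
      then show "coeff (poly C [:x:]) j = 0" by (simp add: coeff_poly_const)
    qed
    show "coeff (poly C [:x:]) D = poly (?s D) x" for x by (rule coeff_poly_const)
    show "Zbar_poly (?s D)" if "Zbar_poly2 C"
      using that by (auto simp: Zbar_poly_def Zbar_poly2_def coeff_map_poly)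
  qed
qed

text \<open>For \<open>f = g * h\<close> with \<open>h\<close> monic, everything in the given
  product except \<open>e\<close> and \<open>g ^ n\<close> forms a monic factor and cancels. So
  \<open>e * coeff g 0 ^ n\<close> is integral, and \<open>G\<close> turns the multiplier into an
  integer polynomial in \<open>n\<close>, to which the criterion for numbers applies.\<close>

lemma Zbar_poly_base_if_powers:
  assumes C: "Zbar_poly2 C" "C \<noteq> 0" and "infinite S"
    and int: "\<And>n. n \<in> S \<Longrightarrow> Zbar_poly (poly C [:of_nat n:] * f ^ n)"
  shows "Zbar_poly f"
proof -
  obtain D E where E: "E \<noteq> 0" "\<And>x. degree (poly C [:x:]) \<le> D"
    "\<And>x. coeff (poly C [:x:]) D = poly E x" "Zbar_poly E"
    using leading_slice[OF C(2)] C(1) by metis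
  obtain G where G: "Zbar_poly G" "G \<noteq> 0" "\<forall>i. coeff (E * G) i \<in> \<int>"
    using Zbar_poly_divides_int_poly[OF E(4,1)] by blast
  show ?thesis
  proof (rule Zbar_polyI_constant_coeffs)
    fix g h assume gh: "f = g * h" "lead_coeff h = 1"
    show "algebraic_int (coeff g 0)"
    proof (rule algebraic_int_base_if_powers[OF G(3) _ \<open>infinite S\<close>])
      show "E * G \<noteq> 0" using E G by simp
      fix n assume n: "n \<in> S"
      define e where "e = poly E (of_nat n)"
      define Cn where "Cn = poly C [:of_nat n:]"
      have "algebraic_int (e * coeff g 0 ^ n)"
      proof (cases "e = 0")
        case False
        have Cn: "lead_coeff Cn = e"
          using E(2,3)[of "of_nat n"] False
          by (metis Cn_def e_def le_antisym le_degree)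
        define M where "M = smult (inverse e) Cn"
        have "Cn * f ^ n = smult e (g ^ n) * (M * h ^ n)"
          using False by (simp add: M_def gh(1) power_mult_distrib mult_ac)
        moreover have "lead_coeff (M * h ^ n) = 1"
          using Cn False gh(2) by (simp add: M_def lead_coeff_mult lead_coeff_power)
        ultimately have "Zbar_poly (smult e (g ^ n))"
          using int[OF n] Zbar_poly_monic_factor by (metis Cn_def)
        then have "algebraic_int (coeff (smult e (g ^ n)) 0)"
          unfolding Zbar_poly_def by blast
        then show ?thesis by (simp add: coeff_0_power)
      qed simp
      then have "algebraic_int (poly G (of_nat n) * (e * coeff g 0 ^ n))"
        by (rule algebraic_int_mult[OF algebraic_int_poly[OF G(1)], rotated]) auto
      then show "algebraic_int (poly (E * G) (of_nat n) * coeff g 0 ^ n)"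
        by (simp add: e_def mult_ac)
    qed
  qed
qed

section \<open>Divisibility of numerators by the denominator\<close>

lemma no_common_root_decomposition:
  fixes p q :: "complex poly"
  assumes "q \<noteq> 0"
  shows "\<exists>g p1 q1. p = g * p1 \<and> q = g * q1 \<and> (\<forall>a. \<not> (poly p1 a = 0 \<and> poly q1 a = 0))"
  using assms
proof (induction "degree q" arbitrary: p q rule: less_induct)
  case less
  show ?case
  proof (cases "\<exists>a. poly p a = 0 \<and> poly q a = 0")
    case False
    then show ?thesis by (intro exI[of _ 1] exI[of _ p] exI[of _ q]) auto
  next
    case True
    then obtain a p' q' where p': "p = [:-a, 1:] * p'" and q': "q = [:-a, 1:] * q'"
      by (auto simp: poly_eq_0_iff_dvd elim!: dvdE)
    have "q' \<noteq> 0" using less.prems q' by auto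
    moreover from this have "degree q' < degree q"
      unfolding q' by (subst degree_mult_eq) auto
    ultimately obtain g p1 q1 where
      "p' = g * p1" "q' = g * q1" "\<forall>a. \<not> (poly p1 a = 0 \<and> poly q1 a = 0)"
      using less.hyps by blast
    then show ?thesis unfolding p' q'
      by (intro exI[of _ "[:-a, 1:] * g"] exI[of _ p1] exI[of _ q1]) (simp only: mult.assoc simp_thms)
  qed
qed

text \<open>Once common roots are removed, a root of \<open>q1\<close> has order at least
  \<open>n\<close> in \<open>poly C [:of_nat n:]\<close>, whose degree is at most \<open>D\<close>.
  Only \<open>n \<le> D\<close> and the zeros of \<open>E\<close> escape, which are finitely many,
  so \<open>q1\<close> is constant.\<close>

lemma dvd_base_if_powers:
  fixes p q :: "complex poly"
  assumes "q \<noteq> 0" "C \<noteq> 0" "infinite S"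
    and dvd: "\<And>n. n \<in> S \<Longrightarrow> q ^ n dvd poly C [:of_nat n:] * p ^ n"
  shows "q dvd p"
proof -
  obtain g p1 q1 where gpq: "p = g * p1" "q = g * q1" "\<And>a. \<not> (poly p1 a = 0 \<and> poly q1 a = 0)"
    using no_common_root_decomposition[OF assms(1)] by blast
  obtain D E where E: "E \<noteq> 0" "\<And>x. degree (poly C [:x:]) \<le> D"
    "\<And>x. coeff (poly C [:x:]) D = poly E x"
    using leading_slice[OF assms(2)] by metis
  have "degree q1 = 0"
  proof (rule ccontr)
    assume "degree q1 \<noteq> 0"
    then obtain a where a: "poly q1 a = 0"
      using alg_closed_imp_poly_has_root by blast
    have "S \<subseteq> {..D} \<union> of_nat -` {x. poly E x = 0}"
    proof
      fix n assume n: "n \<in> S"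
      define Cn where "Cn = poly C [:of_nat n:]"
      show "n \<in> {..D} \<union> of_nat -` {x. poly E x = 0}"
      proof (cases "poly E (of_nat n) = 0")
        case False
        then have "Cn \<noteq> 0" using E(3)[of "of_nat n"] by (auto simp: Cn_def)
        have p1: "poly p1 a \<noteq> 0" "p1 \<noteq> 0" using a gpq(3)[of a] by auto
        have "g ^ n * q1 ^ n dvd g ^ n * (Cn * p1 ^ n)"
          using dvd[OF n] by (simp add: gpq(1,2) Cn_def power_mult_distrib mult_ac)
        then have "q1 ^ n dvd Cn * p1 ^ n"
          using assms(1) gpq(2) by simp
        moreover have "[:-a, 1:] ^ n dvd q1 ^ n"
          using a by (intro dvd_power_same) (simp add: poly_eq_0_iff_dvd)
        ultimately have "[:-a, 1:] ^ n dvd Cn * p1 ^ n"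
          by (meson dvd_trans)
        then have "n \<le> order a (Cn * p1 ^ n)"
          using \<open>Cn \<noteq> 0\<close> p1 by (subst (asm) order_divides) auto
        also have "\<dots> = order a Cn"
          using \<open>Cn \<noteq> 0\<close> p1 by (simp add: order_mult order_0I)
        also have "\<dots> \<le> D"
          using order_degree[OF \<open>Cn \<noteq> 0\<close>, of a] E(2)[of "of_nat n"] by (simp add: Cn_def)
        finally show ?thesis by simp
      qed auto
    qed
    moreover have "finite ({..D} \<union> of_nat -` {x. poly E x = 0})"
      by (intro finite_UnI finite_vimageI poly_roots_finite E(1)) (auto simp: inj_def)
    ultimately show False using \<open>infinite S\<close> finite_subset by blast
  qed
  then obtain c where "q1 = [:c:]" by (metis degree_0_id)
  moreover have "q1 \<noteq> 0" using assms(1) gpq(2) by auto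
  ultimately show ?thesis
    using gpq(1,2) by (simp add: smult_dvd_iff)
qed

section \<open>Elimination by differential operators\<close>

lemma lead_coeff_pderiv:
  fixes p :: "complex poly"
  shows "lead_coeff (pderiv p) = of_nat (degree p) * lead_coeff p"
  by (cases "degree p") (simp_all add: degree_pderiv coeff_pderiv pderiv_eq_0_iff[THEN iffD2])

lemma degree_eq_if_wronskian_zero:
  fixes p q :: "complex poly"
  assumes "p \<noteq> 0" "q \<noteq> 0" "p * pderiv q = q * pderiv p"
  shows "degree p = degree q"
proof -
  have "lead_coeff p * (of_nat (degree q) * lead_coeff q) = lead_coeff q * (of_nat (degree p) * lead_coeff p)"
    using arg_cong[OF assms(3), of lead_coeff] by (simp only: lead_coeff_mult lead_coeff_pderiv)
  with assms(1,2) show ?thesis by simp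
qed

text \<open>Subtracting \<open>smult c q\<close> keeps the Wronskian with \<open>q\<close> zero and
  removes the top coefficient; a nonzero remainder would again have the degree of
  \<open>q\<close>.\<close>

lemma proportional_if_wronskian_zero:
  fixes p q :: "complex poly"
  assumes "p \<noteq> 0" "q \<noteq> 0" "p * pderiv q = q * pderiv p"
  shows "\<exists>c. p = smult c q"
proof -
  define c where "c = lead_coeff p / lead_coeff q"
  define r where "r = p - smult c q"
  have "r * pderiv q = q * pderiv r"
    using assms(3) by (simp add: r_def pderiv_diff pderiv_smult algebra_simps)
  moreover have "coeff r (degree q) = 0"
    using degree_eq_if_wronskian_zero[OF assms] assms(2) by (simp add: r_def c_def)
  ultimately have "r = 0"
    using degree_eq_if_wronskian_zero[of r q] assms(2) by (metis leading_coeff_0_iff)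
  then show ?thesis by (auto simp: r_def)
qed

section \<open>Operators acting on powers\<close>

text \<open>The extra factor \<open>p\<close> removes the exponent \<open>n - 1\<close>, so
  \<open>n = 0\<close> is no exception and \<open>p ^ n\<close> stays a factor.\<close>

lemma mult_pderiv_power:
  fixes p :: "complex poly"
  shows "p * pderiv (p ^ n) = [:of_nat n:] * (p ^ n * pderiv p)"
  by (cases n) (simp_all add: pderiv_power_Suc del: of_nat_Suc power_Suc, simp add: mult_ac)

lemma pderiv_poly_const: "pderiv (poly C [:x:]) = poly (map_poly pderiv C) [:x:]"
  by (induction C) (auto simp: map_poly_pCons pderiv_add pderiv_smult)

text \<open>
  The differential operator \<open>F \<mapsto> P (p\<^sub>k c\<^sub>k F' - (p\<^sub>k c\<^sub>k' + n c\<^sub>k p\<^sub>k') F)\<close> annihilates \<open>c\<^sub>k p\<^sub>k\<^sup>n\<close> and maps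
  \<open>c\<^sub>j p\<^sub>j\<^sup>n\<close> to \<open>c p\<^sub>j\<^sup>n\<close> with the following \<open>c\<close>; here \<open>P = p\<^sub>j R\<close>. As a polynomial in \<open>n\<close>, its leading
  coefficient is a multiple of the Wronskian of \<open>p\<^sub>k\<close> and \<open>p\<^sub>j\<close>.
\<close>
definition eliminated_coeff where
  "eliminated_coeff R pk pj ck cj =
     smult (pj * R * pk) (ck * map_poly pderiv cj - map_poly pderiv ck * cj) +
     pCons 0 (smult (R * (pk * pderiv pj - pj * pderiv pk)) (ck * cj))"

lemma eliminated_coeff_self [simp]: "eliminated_coeff R p p c c = 0"
  by (simp add: eliminated_coeff_def mult.commute)

text \<open>Only the shifted summand reaches index \<open>Suc d\<close> in the outer variable; its
  coefficient there is \<open>R\<close> times the Wronskian and both leading coefficients.\<close>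

lemma eliminated_coeff_nonzero:
  fixes R pk pj :: "complex poly" and ck cj :: "complex poly poly"
  assumes "R \<noteq> 0" "pk * pderiv pj \<noteq> pj * pderiv pk" "ck \<noteq> 0" "cj \<noteq> 0"
  shows "eliminated_coeff R pk pj ck cj \<noteq> 0"
proof -
  define d where "d = degree ck + degree cj"
  have "degree (ck * map_poly pderiv cj - map_poly pderiv ck * cj) \<le> d"
    unfolding d_def
    by (intro degree_diff_le order_trans[OF degree_mult_le] add_mono degree_map_poly_le) auto
  then have "coeff (ck * map_poly pderiv cj - map_poly pderiv ck * cj) (Suc d) = 0"
    by (intro coeff_eq_0) simp
  then have "coeff (eliminated_coeff R pk pj ck cj) (Suc d) =
      R * (pk * pderiv pj - pj * pderiv pk) * coeff (ck * cj) d"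
    unfolding eliminated_coeff_def coeff_add coeff_smult coeff_pCons_Suc by simp
  also have "coeff (ck * cj) d = lead_coeff ck * lead_coeff cj"
    by (simp add: d_def coeff_mult_degree_sum)
  also have "R * (pk * pderiv pj - pj * pderiv pk) * (lead_coeff ck * lead_coeff cj) \<noteq> 0"
    using assms by simp
  finally show ?thesis by auto
qed

lemma Zbar_poly2_eliminated_coeff:
  assumes "Zbar_poly R" "Zbar_poly pk" "Zbar_poly pj" "Zbar_poly2 ck" "Zbar_poly2 cj"
  shows "Zbar_poly2 (eliminated_coeff R pk pj ck cj)"
  unfolding eliminated_coeff_def
  by (intro Zbar_poly2_add Zbar_poly2_pCons Zbar_poly2_smult Zbar_poly2_diff Zbar_poly2_mult
      Zbar_poly2_pderiv Zbar_poly_mult Zbar_poly_diff Zbar_poly_pderiv Zbar_poly_0 assms)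

text \<open>The factor \<open>pj\<close> of the operator turns the derivative of
  \<open>pj ^ n\<close> into a multiple of \<open>pj ^ n\<close>, so the image keeps its
  shape.\<close>

lemma poly_eliminated_coeff:
  fixes n :: nat
  defines "N \<equiv> [:complex_of_nat n:]"
  shows "poly (eliminated_coeff R pk pj ck cj) N * pj ^ n =
    (pj * R) * (pk * poly ck N * pderiv (poly cj N * pj ^ n)
      - (pk * pderiv (poly ck N) + N * (poly ck N * pderiv pk)) * (poly cj N * pj ^ n))"
proof -
  have *: "pj * pderiv (pj ^ n) = N * (pj ^ n * pderiv pj)"
    unfolding N_def by (rule mult_pderiv_power)
  have "(pj * R) * (pk * poly ck N * pderiv (poly cj N * pj ^ n)) =
      R * pk * poly ck N * (poly cj N * (pj * pderiv (pj ^ n)) + pj * pj ^ n * pderiv (poly cj N))"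
    by (simp only: pderiv_mult algebra_simps)
  also have "\<dots> = R * pk * poly ck N * (poly cj N * (N * (pj ^ n * pderiv pj)) + pj * pj ^ n * pderiv (poly cj N))"
    unfolding * ..
  finally have **: "(pj * R) * (pk * poly ck N * pderiv (poly cj N * pj ^ n)) =
      R * pk * poly ck N * (poly cj N * (N * (pj ^ n * pderiv pj)) + pj * pj ^ n * pderiv (poly cj N))" .
  show ?thesis
    unfolding right_diff_distrib[of "pj * R"] ** eliminated_coeff_def
      pderiv_poly_const[of ck "of_nat n", folded N_def]
      pderiv_poly_const[of cj "of_nat n", folded N_def]
      poly_add poly_diff poly_mult poly_smult poly_pCons
    by (simp only: algebra_simps add_0_left mult_zero_left)
qed

text \<open>Induction on \<open>J\<close>: one operator removes summand \<open>k\<close>, and the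
  others keep their shape with integral nonzero coefficients. The right side stays an integral
  multiple of \<open>q ^ n\<close> at the cost of one more factor \<open>q\<close>, counted by
  \<open>m\<close>.\<close>

lemma elimination:
  fixes p :: "'a \<Rightarrow> complex poly"
  assumes "finite J" "i \<notin> J"
    and "\<And>j. j \<in> insert i J \<Longrightarrow> Zbar_poly (p j) \<and> p j \<noteq> 0"
    and "\<And>j. j \<in> insert i J \<Longrightarrow> Zbar_poly2 (c j) \<and> c j \<noteq> 0"
    and "\<And>j k. j \<in> insert i J \<Longrightarrow> k \<in> insert i J \<Longrightarrow> j \<noteq> k \<Longrightarrow> p k * pderiv (p j) \<noteq> p j * pderiv (p k)"
    and q: "Zbar_poly q"
    and "\<And>n. n \<in> S \<Longrightarrow>
      \<exists>h. Zbar_poly h \<and> q ^ m * (\<Sum>j\<in>insert i J. poly (c j) [:of_nat n:] * p j ^ n) = q ^ n * h"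
  shows "\<exists>C m. Zbar_poly2 C \<and> C \<noteq> 0 \<and>
      (\<forall>n\<in>S. \<exists>h. Zbar_poly h \<and> q ^ m * (poly C [:of_nat n:] * p i ^ n) = q ^ n * h)"
  using assms(1-5,7)
proof (induction J arbitrary: c m rule: finite_induct)
  case empty
  then show ?case by (intro exI[of _ "c i"] exI[of _ m]) auto
next
  case (insert k J)
  let ?I = "insert i (insert k J)"
  \<comment> \<open>\<open>R j\<close> complements \<open>p j\<close> to the same product
    \<open>P\<close> for all \<open>j\<close>, so a single linear operator acts on the whole
    sum.\<close>
  define R where "R j = prod p (?I - {j})" for j
  define P where "P = prod p ?I"
  have PR: "P = p j * R j" if "j \<in> ?I" for j
    unfolding P_def R_def using that insert.hyps by (intro prod.remove) auto
  have R: "Zbar_poly (R j)" "R j \<noteq> 0" for j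
    using insert.prems(2) insert.hyps unfolding R_def
    by (auto intro!: Zbar_poly_prod simp: prod_zero_iff)
  have P: "Zbar_poly P"
    using insert.prems(2) unfolding P_def by (intro Zbar_poly_prod) auto
  define c' where "c' j = eliminated_coeff (R j) (p k) (p j) (c k) (c j)" for j
  have "k \<noteq> i" using insert.prems(1) by auto
  show ?case
  proof (rule insert.IH[of c' "Suc m"])
    show "i \<notin> J" using insert.prems(1) by simp
    show "Zbar_poly (p j) \<and> p j \<noteq> 0" if "j \<in> insert i J" for j
      using insert.prems(2) that by auto
    show "p l * pderiv (p j) \<noteq> p j * pderiv (p l)"
      if "j \<in> insert i J" "l \<in> insert i J" "j \<noteq> l" for j l
      using insert.prems(4)[of j l] that by auto
    show "Zbar_poly2 (c' j) \<and> c' j \<noteq> 0" if "j \<in> insert i J" for j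
    proof -
      have "j \<noteq> k" using that \<open>k \<noteq> i\<close> insert.hyps by auto
      then have "p k * pderiv (p j) \<noteq> p j * pderiv (p k)"
        using insert.prems(4)[of j k] that by auto
      moreover have "Zbar_poly2 (c k)" "c k \<noteq> 0" "Zbar_poly2 (c j)" "c j \<noteq> 0"
        using insert.prems(3)[of k] insert.prems(3)[of j] that by auto
      moreover have "Zbar_poly (p k)" "Zbar_poly (p j)"
        using insert.prems(2)[of k] insert.prems(2)[of j] that by auto
      ultimately show ?thesis
        unfolding c'_def using R
        by (intro conjI Zbar_poly2_eliminated_coeff eliminated_coeff_nonzero)
    qed
    fix n assume n: "n \<in> S"
    define N where "N = [:complex_of_nat n:]"
    define M where "M = [:complex_of_nat m:]"
    define a where "a = poly (c k) N"
    define F where "F = (\<Sum>j\<in>?I. poly (c j) N * p j ^ n)"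
    obtain h where h: "Zbar_poly h" "q ^ m * F = q ^ n * h"
      using insert.prems(5)[OF n] unfolding F_def N_def by blast
    have "(\<Sum>j\<in>?I. poly (c' j) N * p j ^ n) =
        (\<Sum>j\<in>?I. P * (p k * a * pderiv (poly (c j) N * p j ^ n)
          - (p k * pderiv a + N * (a * pderiv (p k))) * (poly (c j) N * p j ^ n)))"
      unfolding c'_def a_def N_def by (intro sum.cong refl) (simp only: poly_eliminated_coeff PR)
    also have "\<dots> = P * (p k * a * pderiv F - (p k * pderiv a + N * (a * pderiv (p k))) * F)"
      unfolding F_def by (simp only: sum_distrib_left[symmetric] sum_subtractf pderiv_sum)
    also have "(\<Sum>j\<in>?I. poly (c' j) N * p j ^ n) = (\<Sum>j\<in>insert i J. poly (c' j) N * p j ^ n)"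
      using insert.hyps \<open>k \<noteq> i\<close>
      by (intro sum.mono_neutral_right) (auto simp: c'_def)
    finally have sum: "(\<Sum>j\<in>insert i J. poly (c' j) N * p j ^ n) =
        P * (p k * a * pderiv F - (p k * pderiv a + N * (a * pderiv (p k))) * F)" .
    \<comment> \<open>The relation is differentiated and multiplied by \<open>q\<close>, so that
      \<open>mult_pderiv_power\<close> keeps \<open>q ^ n\<close> as a factor; this raises
      \<open>m\<close> to \<open>Suc m\<close>.\<close>
    have "q * (q ^ m * pderiv F + F * pderiv (q ^ m)) = q * (q ^ n * pderiv h + h * pderiv (q ^ n))"
      using arg_cong[OF h(2), of pderiv] by (simp only: pderiv_mult)
    then have "q ^ Suc m * pderiv F + F * (q * pderiv (q ^ m)) =
        q ^ n * (q * pderiv h) + h * (q * pderiv (q ^ n))"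
      by (simp add: algebra_simps)
    then have "q ^ Suc m * pderiv F + M * pderiv q * (q ^ m * F) =
        q ^ n * (q * pderiv h) + h * (N * (q ^ n * pderiv q))"
      unfolding mult_pderiv_power M_def[symmetric] N_def[symmetric] by (simp only: mult_ac)
    then have "q ^ Suc m * pderiv F =
        q ^ n * (q * pderiv h) + h * (N * (q ^ n * pderiv q)) - M * pderiv q * (q ^ n * h)"
      unfolding h(2) eq_diff_eq .
    also have "\<dots> = q ^ n * (q * pderiv h + N * (h * pderiv q) - M * pderiv q * h)"
      by (simp only: algebra_simps)
    finally have dF: "q ^ Suc m * pderiv F =
        q ^ n * (q * pderiv h + N * (h * pderiv q) - M * pderiv q * h)" .
    define h' where "h' = P * (p k * a * (q * pderiv h + N * (h * pderiv q) - M * pderiv q * h)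
        - (p k * pderiv a + N * (a * pderiv (p k))) * (q * h))"
    have "Zbar_poly N" "Zbar_poly M"
      unfolding N_def M_def by (rule Zbar_poly_of_nat)+
    moreover from this have "Zbar_poly a"
      unfolding a_def using insert.prems(3)[of k] by (intro Zbar_poly2_poly) auto
    moreover have "Zbar_poly (p k)" using insert.prems(2) by auto
    ultimately have "Zbar_poly h'"
      unfolding h'_def
      by (intro Zbar_poly_mult Zbar_poly_diff Zbar_poly_add Zbar_poly_pderiv P q h(1))
    moreover have "q ^ Suc m * (\<Sum>j\<in>insert i J. poly (c' j) N * p j ^ n) =
        P * (p k * a * (q ^ Suc m * pderiv F)
          - (p k * pderiv a + N * (a * pderiv (p k))) * (q * (q ^ m * F)))"
      unfolding sum by (simp only: algebra_simps power_Suc)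
    moreover have "\<dots> = q ^ n * h'"
      unfolding dF h(2) h'_def by (simp only: algebra_simps)
    ultimately show "\<exists>h. Zbar_poly h \<and>
        q ^ Suc m * (\<Sum>j\<in>insert i J. poly (c' j) [:of_nat n:] * p j ^ n) = q ^ n * h"
      unfolding N_def by metis
  qed
qed

section \<open>Rational functions\<close>

lemma rf_of_poly_add: "rf_of_poly (p + q) = rf_of_poly p + rf_of_poly q"
  and rf_of_poly_mult: "rf_of_poly (p * q) = rf_of_poly p * rf_of_poly q"
  and rf_of_poly_eq_iff: "rf_of_poly p = rf_of_poly q \<longleftrightarrow> p = q"
  and rf_of_poly_0: "rf_of_poly 0 = 0"
  and rf_of_poly_1: "rf_of_poly 1 = 1"
  by (simp_all add: rf_of_poly_def eq_fract Zero_fract_def One_fract_def)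

lemma rf_of_poly_power: "rf_of_poly (p ^ n) = rf_of_poly p ^ n"
  by (induction n) (simp_all add: rf_of_poly_1 rf_of_poly_mult)

lemma rf_of_poly_sum: "rf_of_poly (sum g X) = (\<Sum>x\<in>X. rf_of_poly (g x))"
  by (induction X rule: infinite_finite_induct) (simp_all add: rf_of_poly_0 rf_of_poly_add)

lemma alg_ratfun_Zbar:
  assumes "alg_ratfun f"
  obtains p q where "Zbar_poly p" "Zbar_poly q" "q \<noteq> 0" "f * rf_of_poly q = rf_of_poly p"
proof -
  obtain p q where pq: "q \<noteq> 0" "\<forall>i. algebraic (coeff p i)" "\<forall>i. algebraic (coeff q i)" "f = Fract p q"
    using assms by (auto simp: alg_ratfun_def)
  obtain s t :: int where s: "s \<noteq> 0" "Zbar_poly (smult (of_int s) p)"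
    and t: "t \<noteq> 0" "Zbar_poly (smult (of_int t) q)"
    using Zbar_poly_multiple pq(2,3) by metis
  show ?thesis
  proof
    show "Zbar_poly (smult (of_int t) (smult (of_int s) p))"
      by (rule Zbar_poly_smult[OF _ s(2)]) simp
    show "Zbar_poly (smult (of_int s) (smult (of_int t) q))"
      by (rule Zbar_poly_smult[OF _ t(2)]) simp
    show "smult (of_int s) (smult (of_int t) q) \<noteq> 0" using pq(1) s t by simp
    show "f * rf_of_poly (smult (of_int s) (smult (of_int t) q)) =
        rf_of_poly (smult (of_int t) (smult (of_int s) p))"
      using pq(1) by (simp add: pq(4) rf_of_poly_def eq_fract mult_ac)
  qed
qed

lemma common_denominator:
  fixes f :: "'a \<Rightarrow> ratfun"
  assumes "finite I" "\<And>i. i \<in> I \<Longrightarrow> alg_ratfun (f i)"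
  shows "\<exists>p q. Zbar_poly q \<and> q \<noteq> 0 \<and> (\<forall>i\<in>I. Zbar_poly (p i) \<and> f i * rf_of_poly q = rf_of_poly (p i))"
proof -
  have "\<forall>i\<in>I. \<exists>p q. Zbar_poly p \<and> Zbar_poly q \<and> q \<noteq> 0 \<and> f i * rf_of_poly q = rf_of_poly p"
    using assms(2) by (meson alg_ratfun_Zbar)
  then obtain p q where pq: "\<And>i. i \<in> I \<Longrightarrow> Zbar_poly (p i) \<and> Zbar_poly (q i) \<and> q i \<noteq> 0 \<and>
      f i * rf_of_poly (q i) = rf_of_poly (p i)"
    by metis
  have "f i * rf_of_poly (prod q I) = rf_of_poly (p i * prod q (I - {i}))" if "i \<in> I" for i
    using pq[OF that] prod.remove[OF assms(1) that, of q]
    by (simp add: rf_of_poly_mult mult.assoc[symmetric])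
  then show ?thesis
    using pq assms(1)
    by (intro exI[of _ "\<lambda>i. p i * prod q (I - {i})"] exI[of _ "prod q I"])
       (auto simp: prod_zero_iff intro!: Zbar_poly_prod Zbar_poly_mult)
qed

lemma common_int_multiple:
  fixes x :: "'a \<Rightarrow> complex"
  assumes "finite I" "\<And>i. i \<in> I \<Longrightarrow> algebraic (x i)"
  shows "\<exists>t::int. t \<noteq> 0 \<and> (\<forall>i\<in>I. algebraic_int (of_int t * x i))"
  using assms
proof (induction I)
  case empty
  show ?case by (rule exI[of _ 1]) simp
next
  case (insert i I)
  then obtain t u :: int where t: "t \<noteq> 0" "\<forall>i\<in>I. algebraic_int (of_int t * x i)"
    and u: "u \<noteq> 0" "algebraic_int (of_int u * x i)"
    using algebraic_int_multiple by (metis insertI1 insertI2)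
  have "algebraic_int (of_int t * (of_int u * x i))"
    by (rule algebraic_int_mult[OF _ u(2)]) simp
  then have "algebraic_int (of_int (u * t) * x i)"
    by (simp only: of_int_mult mult.assoc mult.left_commute)
  moreover have "algebraic_int (of_int (u * t) * x j)" if "j \<in> I" for j
    unfolding of_int_mult mult.assoc
    by (rule algebraic_int_mult[OF _ t(2)[rule_format, OF that]]) simp
  ultimately have "\<forall>j\<in>insert i I. algebraic_int (of_int (u * t) * x j)"
    by blast
  moreover have "u * t \<noteq> 0" using t(1) u(1) by simp
  ultimately show ?case by blast
qed

theorem theorem2p8:
  fixes k :: nat and f :: "nat \<Rightarrow> ratfun" and lam :: "nat \<Rightarrow> complex" and S :: "nat set"
  assumes "\<And>i. i \<in> {1..k} \<Longrightarrow> alg_ratfun (f i) \<and> \<not> rf_const (f i)"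
      and "\<And>i. i \<in> {1..k} \<Longrightarrow> algebraic (lam i) \<and> lam i \<noteq> 0"
      and "\<And>i j. i \<in> {1..k} \<Longrightarrow> j \<in> {1..k} \<Longrightarrow> i \<noteq> j \<Longrightarrow> \<not> rf_const (f i / f j)"
      and "infinite S"
      and "\<And>n. n \<in> S \<Longrightarrow> in_Zbar_poly (\<Sum>i=1..k. rf_of_poly [:lam i:] * (f i) ^ n)"
  shows "\<forall>i\<in>{1..k}. in_Zbar_poly (f i)"
proof
  fix i assume i: "i \<in> {1..k}"
  obtain p q where q: "Zbar_poly q" "q \<noteq> 0"
    and p: "\<And>j. j \<in> {1..k} \<Longrightarrow> Zbar_poly (p j)"
    and fp: "\<And>j. j \<in> {1..k} \<Longrightarrow> f j * rf_of_poly q = rf_of_poly (p j)"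
    using common_denominator[of "{1..k}" f] assms(1) by (metis finite_atLeastAtMost)
  obtain t :: int where t: "t \<noteq> 0" "\<And>j. j \<in> {1..k} \<Longrightarrow> algebraic_int (of_int t * lam j)"
    using common_int_multiple[of "{1..k}" lam] assms(2) by (metis finite_atLeastAtMost)
  have rq: "rf_of_poly q \<noteq> 0"
    using q(2) by (simp add: rf_of_poly_0[symmetric] rf_of_poly_eq_iff)
  have f_eq: "f j = rf_of_poly (p j) / rf_of_poly q" if "j \<in> {1..k}" for j
    using fp[OF that] rq by (simp add: field_simps)
  have p0: "p j \<noteq> 0" if "j \<in> {1..k}" for j
  proof
    assume "p j = 0"
    then have "f j = rf_of_poly [:0:]" using f_eq[OF that] by (simp add: rf_of_poly_0)
    then show False using assms(1)[OF that] unfolding rf_const_def by blast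
  qed
  have wronskian: "p l * pderiv (p j) \<noteq> p j * pderiv (p l)"
    if jl: "j \<in> {1..k}" "l \<in> {1..k}" "j \<noteq> l" for j l
  proof
    assume "p l * pderiv (p j) = p j * pderiv (p l)"
    then obtain c where "p j = smult c (p l)"
      using proportional_if_wronskian_zero[of "p j" "p l"] p0 jl by metis
    then have "rf_of_poly (p j) = rf_of_poly [:c:] * rf_of_poly (p l)"
      by (simp add: rf_of_poly_mult[symmetric])
    moreover have "rf_of_poly (p l) \<noteq> 0"
      using p0[OF jl(2)] by (simp add: rf_of_poly_0[symmetric] rf_of_poly_eq_iff)
    ultimately have "f j / f l = rf_of_poly [:c:]"
      using rq by (simp add: f_eq[OF jl(1)] f_eq[OF jl(2)])
    then show False using assms(3)[OF jl] unfolding rf_const_def by blast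
  qed
  \<comment> \<open>The initial coefficients are constant in both variables; \<open>t\<close> makes
    all \<open>lam j\<close> integral at once.\<close>
  define c :: "nat \<Rightarrow> complex poly poly" where "c j = [:[:of_int t * lam j:]:]" for j
  have ins: "insert i ({1..k} - {i}) = {1..k}" using i by auto
  have "\<exists>C m. Zbar_poly2 C \<and> C \<noteq> 0 \<and>
      (\<forall>n\<in>S. \<exists>h. Zbar_poly h \<and> q ^ m * (poly C [:of_nat n:] * p i ^ n) = q ^ n * h)"
  \<comment> \<open>Multiplying the given sums by \<open>q ^ n\<close> yields the relation without
    extra powers of \<open>q\<close>, so \<open>m\<close> starts at 0.\<close>
  proof (rule elimination[where J = "{1..k} - {i}" and c = c and m = 0], unfold ins)
    show "Zbar_poly2 (c j) \<and> c j \<noteq> 0" if "j \<in> {1..k}" for j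
      using t(1) t(2)[OF that] assms(2)[OF that] unfolding c_def
      by (simp add: Zbar_poly2_pCons Zbar_poly_pCons Zbar_poly2_0)
    fix n assume "n \<in> S"
    then obtain g where g: "Zbar_poly g" "(\<Sum>j=1..k. rf_of_poly [:lam j:] * f j ^ n) = rf_of_poly g"
      using assms(5) unfolding in_Zbar_poly_def Zbar_poly_def by blast
    have "rf_of_poly (\<Sum>j=1..k. [:lam j:] * p j ^ n) =
        (\<Sum>j=1..k. rf_of_poly [:lam j:] * f j ^ n) * rf_of_poly q ^ n"
      unfolding rf_of_poly_sum sum_distrib_right
      by (intro sum.cong refl)
         (simp only: rf_of_poly_mult rf_of_poly_power fp[symmetric] power_mult_distrib mult.assoc)
    also have "\<dots> = rf_of_poly (q ^ n * g)"
      unfolding g(2) by (simp only: rf_of_poly_mult rf_of_poly_power mult.commute)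
    finally have eq: "(\<Sum>j=1..k. [:lam j:] * p j ^ n) = q ^ n * g"
      by (simp only: rf_of_poly_eq_iff)
    have "q ^ 0 * (\<Sum>j=1..k. poly (c j) [:of_nat n:] * p j ^ n) =
        smult (of_int t) (\<Sum>j=1..k. [:lam j:] * p j ^ n)"
      by (simp add: c_def smult_sum2)
    also have "\<dots> = q ^ n * smult (of_int t) g"
      unfolding eq by simp
    finally show "\<exists>h. Zbar_poly h \<and>
        q ^ 0 * (\<Sum>j=1..k. poly (c j) [:of_nat n:] * p j ^ n) = q ^ n * h"
      using Zbar_poly_smult[OF _ g(1), of "of_int t"] by auto
  qed (use p p0 wronskian q in auto)
  then obtain C m where C: "Zbar_poly2 C" "C \<noteq> 0"
    and h: "\<And>n. n \<in> S \<Longrightarrow> \<exists>h. Zbar_poly h \<and> q ^ m * (poly C [:of_nat n:] * p i ^ n) = q ^ n * h"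
    by blast
  \<comment> \<open>The exponent \<open>m\<close> does not depend on \<open>n\<close>, so
    \<open>q ^ m\<close> can be absorbed into the coefficient family.\<close>
  define C' where "C' = smult (q ^ m) C"
  have C': "Zbar_poly2 C'" "C' \<noteq> 0"
    using C q by (auto simp: C'_def intro: Zbar_poly2_smult Zbar_poly_power)
  have h': "\<exists>h. Zbar_poly h \<and> poly C' [:of_nat n:] * p i ^ n = q ^ n * h" if "n \<in> S" for n
    using h[OF that] by (simp add: C'_def mult.assoc)
  have "q dvd p i"
    by (rule dvd_base_if_powers[OF q(2) C'(2) assms(4)]) (metis h' dvd_triv_left)
  then obtain F where F: "p i = q * F" by (elim dvdE)
  have "Zbar_poly F"
  proof (rule Zbar_poly_base_if_powers[OF C' assms(4)])
    fix n assume "n \<in> S"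
    then obtain h where "Zbar_poly h" "poly C' [:of_nat n:] * (q * F) ^ n = q ^ n * h"
      using h' F by metis
    moreover from this(2) have "q ^ n * (poly C' [:of_nat n:] * F ^ n) = q ^ n * h"
      by (simp only: power_mult_distrib mult_ac)
    ultimately show "Zbar_poly (poly C' [:of_nat n:] * F ^ n)"
      using q(2) by simp
  qed
  moreover have "f i = rf_of_poly F"
    using f_eq[OF i] rq by (simp add: F rf_of_poly_mult)
  ultimately show "in_Zbar_poly (f i)"
    unfolding in_Zbar_poly_def Zbar_poly_def by blast
qed

end
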